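(* Let $T>0$, $d\in\mathbb N$, let $p\ge2$ be an even integer, let $\pi=(\pi_n)_{n\ge1}$ be a sequence of partitions of $[0,T]$ and let $S\in V_p(\pi)\cap C([0,T],\mathbb R^d)$. Then for all $f\in C^p(\mathbb R^d,\mathbb R)$ the limit of compensated Riemann sums $$\int_0^t\langle\nabla f(S(s)),dS(s)\rangle:=\lim_{n\to\infty}\sum_{[t_j,t_{j+1}]\in\pi_n}\sum_{k=1}^{p-1}\frac1{k!}\bigl\langle\nabla^kf(S(t_j)),(S(t_{j+1}\wedge t)-S(t_j\wedge t))^{\otimes k}\bigr\rangle$$ exists for every $t\in[0,T]$ and satisfies the pathwise change of variable formula $$f(S(t))-f(S(0))=\int_0^t\langle\nabla f(S(s)),dS(s)\rangle+\frac1{p!}\int_0^t\langle\nabla^pf(S(s)),d[S]^p(s)\rangle.$$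
   Context: Each partition $\pi_n=\{0=t^n_0<t^n_1<\dots<t^n_{N(\pi_n)}=T\}$ is finite; $[t_j,t_{j+1}]\in\pi_n$ means that $t_j<t_{j+1}$ are consecutive points of $\pi_n$. $\operatorname{osc}(S,\pi_n):=\max_{[t_j,t_{j+1}]\in\pi_n}\max_{r,s\in[t_j,t_{j+1}]}|S(s)-S(r)|$. $T_k(\mathbb R^d)=(\mathbb R^d)^{\otimes k}$ with its canonical inner product $\langle\cdot,\cdot\rangle$; $\mathrm{Sym}_k(\mathbb R^d)\subset T_k(\mathbb R^d)$ is the subspace of symmetric tensors (invariant under permutation of arguments). $\nabla^kf(x)\in\mathrm{Sym}_k(\mathbb R^d)$ is the $k$-th order derivative. $\mathbb H_p[X_1,\dots,X_d]$ is the space of homogeneous polynomials of degree $p$ in $d$ variables; $\mathrm{Sym}_p(\mathbb R^d)$ is identified with its dual, with pairing determined by $\langle P,v^{\otimes p}\rangle=P(v)$. Definition of $V_p(\pi)$ for $\mathbb R^d$-valued paths ($p$ even): $S\in C([0,T],\mathbb R^d)$ has a $p$-th variation along $\pi=(\pi_n)$, written $S\in V_p(\pi)$, if $\operatorname{osc}(S,\pi_n)\to0$ and there is a $\mathrm{Sym}_p(\mathbb R^d)$-valued measure $\mu_S$ on $[0,T]$ without atoms such that for all $g\in C([0,T],\mathbb H_p[X_1,\dots,X_d])$ $$\lim_{n\to\infty}\sum_{[t_j,t_{j+1}]\in\pi_n}\langle g(t_j),(S(t_{j+1})-S(t_j))^{\otimes p}\rangle=\int_0^T\langle g,d\mu_S\rangle.$$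 In that case $[S]^p(t):=\mu_S([0,t])\in\mathrm{Sym}_p(\mathbb R^d)$, and $\int_0^t\langle\cdot,d[S]^p\rangle$ denotes integration against $\mu_S$ on $[0,t]$. *)

theory Defs
  imports "HOL-Analysis.Analysis" "HOL-Library.Poly_Mapping"
begin

section \<open>Partitions\<close>

definition is_partition :: "real \<Rightarrow> real set \<Rightarrow> bool" where
  "is_partition T P \<longleftrightarrow> finite P \<and> P \<subseteq> {0..T} \<and> 0 \<in> P \<and> T \<in> P"

definition intervals :: "real set \<Rightarrow> (real \<times> real) set" where
  "intervals P = {(a, b). a \<in> P \<and> b \<in> P \<and> a < b \<and> P \<inter> {a<..<b} = {}}"

definition osc :: "(real \<Rightarrow> 'a::real_normed_vector) \<Rightarrow> real set \<Rightarrow> real" where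
  "osc S P = (MAX (a, b) \<in> intervals P. SUP (r, s) \<in> {a..b} \<times> {a..b}. norm (S s - S r))"


section \<open>Tensors\<close>

text \<open>The space \<open>T\<^sub>k(\<real>\<^sup>d)\<close> is rendered in coordinates of the standard basis: a tensor is a
  function on multi-indices (lists of indices), vanishing off the lists of length \<open>k\<close>.\<close>

definition Tens :: "nat \<Rightarrow> ('d::finite list \<Rightarrow> real) set" where
  "Tens k = {A. \<forall>I. length I \<noteq> k \<longrightarrow> A I = 0}"

text \<open>Two lists have the same multiset of entries iff they are permutations of each other.\<close>

definition Sym :: "nat \<Rightarrow> ('d::finite list \<Rightarrow> real) set" where
  "Sym k = {A \<in> Tens k. \<forall>I J. mset I = mset J \<longrightarrow> A I = A J}"

definition tensor_inner :: "nat \<Rightarrow> ('d::finite list \<Rightarrow> real) \<Rightarrow> ('d list \<Rightarrow> real) \<Rightarrow> real" where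
  "tensor_inner k A B = (\<Sum>I | length I = k. A I * B I)"

definition tensor_power :: "nat \<Rightarrow> real ^ 'd \<Rightarrow> ('d::finite list \<Rightarrow> real)" where
  "tensor_power k v = (\<lambda>I. if length I = k then (\<Prod>i\<leftarrow>I. v $ i) else 0)"


section \<open>Homogeneous polynomials\<close>

text \<open>Monomials in the variables \<open>X\<^sub>i\<close> (\<open>i :: 'd\<close>) are multisets of indices, and
  \<^typ>\<open>'d multiset \<Rightarrow>\<^sub>0 real\<close> is the polynomial ring.\<close>

definition homogeneous :: "nat \<Rightarrow> ('d::finite multiset \<Rightarrow>\<^sub>0 real) set" where
  "homogeneous p = {P. \<forall>M \<in> Poly_Mapping.keys P. size M = p}"

definition poly_eval :: "('d::finite multiset \<Rightarrow>\<^sub>0 real) \<Rightarrow> real ^ 'd \<Rightarrow> real" where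
  "poly_eval P v = (\<Sum>M \<in> Poly_Mapping.keys P. Poly_Mapping.lookup P M * (\<Prod>i\<in>#M. v $ i))"

text \<open>The symmetric tensor of a homogeneous polynomial of degree \<open>p\<close>: the coefficient of each
  monomial is shared equally among the multi-indices of that monomial. Through the inner product
  this identifies the homogeneous polynomials with the dual of \<^term>\<open>Sym p\<close>;
  lemma \<open>poly_pairing_tensor_power\<close> below is the normalisation that determines the pairing.\<close>

definition poly_tensor :: "nat \<Rightarrow> ('d::finite multiset \<Rightarrow>\<^sub>0 real) \<Rightarrow> ('d list \<Rightarrow> real)" where
  "poly_tensor p P = (\<lambda>I. if length I = p
     then Poly_Mapping.lookup P (mset I) / real (card {J. mset J = mset I}) else 0)"

definition poly_pairing :: "nat \<Rightarrow> ('d::finite multiset \<Rightarrow>\<^sub>0 real) \<Rightarrow> ('d list \<Rightarrow> real) \<Rightarrow> real" where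
  "poly_pairing p P A = tensor_inner p (poly_tensor p P) A"

lemma finite_lists_length: "finite {I :: 'd::finite list. length I = k}"
  using finite_lists_length_eq[of "UNIV :: 'd set" k] by simp

lemma finite_mset_eq: "finite {J :: 'a list. mset J = M}"
proof -
  have "{J. mset J = M} \<subseteq> {J. set J \<subseteq> set_mset M \<and> length J = size M}"
    by auto
  then show ?thesis
    using finite_lists_length_eq[of "set_mset M" "size M"] finite_subset by blast
qed

lemma poly_tensor_Sym: "poly_tensor p P \<in> Sym p"
  unfolding Sym_def Tens_def poly_tensor_def by (auto dest: mset_eq_length)

lemma poly_pairing_tensor_power:
  fixes P :: "'d::finite multiset \<Rightarrow>\<^sub>0 real"
  assumes "P \<in> homogeneous p"
  shows "poly_pairing p P (tensor_power p v) = poly_eval P v"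
proof -
  let ?c = "Poly_Mapping.lookup P" and ?K = "Poly_Mapping.keys P"
  let ?L = "{I :: 'd list. length I = p}"
  let ?h = "\<lambda>I. ?c (mset I) / real (card {J. mset J = mset I}) * (\<Prod>i\<leftarrow>I. v $ i)"
  have pm: "(\<Prod>i\<leftarrow>I. v $ i) = (\<Prod>i\<in>#mset I. v $ i)" for I
    by (simp flip: prod_mset_prod_list)
  have K: "size M = p" if "M \<in> ?K" for M
    using assms that by (auto simp: homogeneous_def)
  have fin: "finite (mset ` ?L)"
    using finite_lists_length by blast
  have sub: "?K \<subseteq> mset ` ?L"
  proof
    fix M assume M: "M \<in> ?K"
    obtain J where "mset J = M" using ex_mset by blast
    with K[OF M] show "M \<in> mset ` ?L" by (auto simp flip: size_mset)
  qed
  have "poly_pairing p P (tensor_power p v) = (\<Sum>I\<in>?L. ?h I)"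
    unfolding poly_pairing_def tensor_inner_def poly_tensor_def tensor_power_def
    by (intro sum.cong) auto
  also have "\<dots> = (\<Sum>M\<in>mset ` ?L. \<Sum>I | I \<in> ?L \<and> mset I = M. ?h I)"
    by (rule sum.image_gen[OF finite_lists_length])
  also have "\<dots> = (\<Sum>M\<in>mset ` ?L. ?c M * (\<Prod>i\<in>#M. v $ i))"
  proof (rule sum.cong[OF refl])
    fix M assume "M \<in> mset ` ?L"
    then obtain I0 where I0: "length I0 = p" "mset I0 = M" by auto
    have eq: "{I. I \<in> ?L \<and> mset I = M} = {J. mset J = M}"
      using I0 by (auto dest: mset_eq_length)
    have "card {J. mset J = M} \<noteq> 0"
      using I0 finite_mset_eq[of M] by auto
    moreover have "(\<Sum>I | I \<in> ?L \<and> mset I = M. ?h I)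
        = (\<Sum>I | mset I = M. ?c M / real (card {J. mset J = M}) * (\<Prod>i\<in>#M. v $ i))"
      unfolding eq by (intro sum.cong) (auto simp: pm)
    ultimately show "(\<Sum>I | I \<in> ?L \<and> mset I = M. ?h I) = ?c M * (\<Prod>i\<in>#M. v $ i)"
      by simp
  qed
  also have "\<dots> = poly_eval P v"
    unfolding poly_eval_def using fin sub
    by (intro sum.mono_neutral_right) (auto simp: in_keys_iff)
  finally show ?thesis .
qed


section \<open>Functions of class \<open>C\<^sup>k\<close> and their derivatives\<close>

primrec Ck :: "nat \<Rightarrow> (real ^ 'd::finite \<Rightarrow> real) \<Rightarrow> bool" where
  "Ck 0 f \<longleftrightarrow> continuous_on UNIV f"
| "Ck (Suc k) f \<longleftrightarrow> (\<forall>x. f differentiable (at x)) \<and>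
     (\<forall>v. Ck k (\<lambda>x. frechet_derivative f (at x) v))"

primrec iterated_partial :: "'d::finite list \<Rightarrow> (real ^ 'd \<Rightarrow> real) \<Rightarrow> real ^ 'd \<Rightarrow> real" where
  "iterated_partial [] f = f"
| "iterated_partial (i # I) f = iterated_partial I (\<lambda>x. frechet_derivative f (at x) (axis i 1))"

definition nabla :: "nat \<Rightarrow> (real ^ 'd::finite \<Rightarrow> real) \<Rightarrow> real ^ 'd \<Rightarrow> ('d list \<Rightarrow> real)" where
  "nabla k f x = (\<lambda>I. if length I = k then iterated_partial I f x else 0)"


section \<open>Signed and tensor-valued measures\<close>

text \<open>In this section the argument \<open>M\<close> only provides a space and its measurable sets.\<close>

definition signed_measure :: "'a measure \<Rightarrow> ('a set \<Rightarrow> real) \<Rightarrow> bool" where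
  "signed_measure M \<nu> \<longleftrightarrow>
     (\<forall>A :: nat \<Rightarrow> 'a set. range A \<subseteq> sets M \<longrightarrow> disjoint_family A \<longrightarrow>
        (\<lambda>n. \<nu> (A n)) sums \<nu> (\<Union>n. A n))"

text \<open>The upper variation \<open>\<nu>\<^sup>+\<close> of the Jordan decomposition \<open>\<nu> = \<nu>\<^sup>+ - \<nu>\<^sup>-\<close>, where
  \<open>\<nu>\<^sup>- = (- \<nu>)\<^sup>+\<close>. Negative values are truncated by \<^const>\<open>ennreal\<close>, which does not affect the
  supremum, as \<open>\<nu> {} = 0\<close>.\<close>

definition upper_variation :: "'a measure \<Rightarrow> ('a set \<Rightarrow> real) \<Rightarrow> 'a measure" where
  "upper_variation M \<nu> = measure_of (space M) (sets M)
     (\<lambda>A. SUP B \<in> {B \<in> sets M. B \<subseteq> A}. ennreal (\<nu> B))"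

definition signed_integral :: "'a measure \<Rightarrow> ('a set \<Rightarrow> real) \<Rightarrow> ('a \<Rightarrow> real) \<Rightarrow> real" where
  "signed_integral M \<nu> h =
     integral\<^sup>L (upper_variation M \<nu>) h - integral\<^sup>L (upper_variation M (\<lambda>A. - \<nu> A)) h"

lemma signed_measure_empty:
  assumes "signed_measure M \<nu>" shows "\<nu> {} = 0"
proof -
  have "(\<lambda>n::nat. \<nu> {}) sums \<nu> {}"
    using assms[unfolded signed_measure_def, rule_format, of "\<lambda>_. {}"]
    by (simp add: disjoint_family_on_def)
  then have "(\<lambda>n::nat. \<nu> {}) \<longlonglongrightarrow> 0"
    using summable_LIMSEQ_zero sums_summable by blast
  then show ?thesis by (simp add: LIMSEQ_const_iff)
qed

lemma signed_measure_Un: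
  assumes "signed_measure M \<nu>" "A \<in> sets M" "B \<in> sets M" "A \<inter> B = {}"
  shows "\<nu> (A \<union> B) = \<nu> A + \<nu> B"
proof -
  have "range (binaryset A B) \<subseteq> sets M" "disjoint_family (binaryset A B)"
    using assms by (auto simp: binaryset_def disjoint_family_on_def)
  then have 1: "(\<lambda>n. \<nu> (binaryset A B n)) sums \<nu> (A \<union> B)"
    using assms(1) by (metis signed_measure_def UN_binaryset_eq)
  have "(\<lambda>n. \<nu> (binaryset A B n)) sums (\<nu> A + \<nu> B)"
    using signed_measure_empty[OF assms(1)] by (rule binaryset_sums)
  then show ?thesis using 1 sums_unique2 by blast
qed

lemma emeasure_upper_variation:
  assumes \<nu>: "signed_measure M \<nu>" and A: "A \<in> sets M"
  shows "emeasure (upper_variation M \<nu>) A = (SUP B \<in> {B \<in> sets M. B \<subseteq> A}. ennreal (\<nu> B))"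
proof -
  define \<phi> where "\<phi> = (\<lambda>A. SUP B \<in> {B \<in> sets M. B \<subseteq> A}. ennreal (\<nu> B))"
  have up: "ennreal (\<nu> B) \<le> \<phi> A" if "B \<in> sets M" "B \<subseteq> A" for A B
    unfolding \<phi>_def using that by (intro SUP_upper) auto
  have mono: "\<phi> A \<le> \<phi> B" if "A \<subseteq> B" for A B
    unfolding \<phi>_def using that by (intro SUP_subset_mono) auto
  have empty: "\<phi> {} = 0"
  proof -
    have "{B \<in> sets M. B \<subseteq> {}} = {{}}" by auto
    then show ?thesis by (simp add: \<phi>_def signed_measure_empty[OF \<nu>])
  qed
  have super: "\<phi> A + \<phi> B \<le> \<phi> (A \<union> B)"
    if AB: "A \<inter> B = {}" for A B
  proof -
    have ne: "{C \<in> sets M. C \<subseteq> A} \<noteq> {}" for A by auto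
    have "ennreal (\<nu> C) + ennreal (\<nu> D) \<le> \<phi> (A \<union> B)"
      if C: "C \<in> sets M" "C \<subseteq> A" and D: "D \<in> sets M" "D \<subseteq> B" for C D
    proof (cases "\<nu> C \<ge> 0 \<and> \<nu> D \<ge> 0")
      case True
      have "\<nu> (C \<union> D) = \<nu> C + \<nu> D"
        using signed_measure_Un[OF \<nu>] C D AB by blast
      then have "ennreal (\<nu> C) + ennreal (\<nu> D) = ennreal (\<nu> (C \<union> D))"
        using True by simp
      also have "\<dots> \<le> \<phi> (A \<union> B)" using C D by (intro up) auto
      finally show ?thesis .
    next
      case False
      then have "ennreal (\<nu> C) = 0 \<or> ennreal (\<nu> D) = 0"
        by (auto intro: ennreal_neg)
      moreover have "ennreal (\<nu> C) \<le> \<phi> (A \<union> B)" "ennreal (\<nu> D) \<le> \<phi> (A \<union> B)"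
        using C D by (auto intro!: up)
      ultimately show ?thesis by auto
    qed
    then show ?thesis
      unfolding \<phi>_def[THEN fun_cong, of A] \<phi>_def[THEN fun_cong, of B]
        ennreal_SUP_add_left[OF ne, symmetric] ennreal_SUP_add_right[OF ne]
      by (auto intro!: SUP_least)
  qed
  have "countably_additive (sets M) \<phi>"
    unfolding countably_additive_def
  proof (intro allI impI)
    fix A :: "nat \<Rightarrow> 'a set"
    assume A: "range A \<subseteq> sets M" "disjoint_family A" "\<Union> (range A) \<in> sets M"
    have "(\<Sum>i<n. \<phi> (A i)) \<le> \<phi> (\<Union>i<n. A i)" for n
    proof (induction n)
      case (Suc n)
      have "A i \<inter> A n = {}" if "i < n" for i
        using A(2) that by (auto simp: disjoint_family_on_def)
      then have "(\<Union>i<n. A i) \<inter> A n = {}" by blast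
      from super[OF this] have "\<phi> (\<Union>i<n. A i) + \<phi> (A n) \<le> \<phi> (\<Union>i<Suc n. A i)"
        by (simp add: lessThan_Suc Un_commute)
      from order_trans[OF add_right_mono[OF Suc] this] show ?case
        by (simp only: sum.lessThan_Suc)
    qed (simp add: empty)
    then have "(\<Sum>i<n. \<phi> (A i)) \<le> \<phi> (\<Union>i. A i)" for n
      by (rule order_trans) (auto intro!: mono)
    then have ge: "(suminf (\<lambda>i. \<phi> (A i))) \<le> \<phi> (\<Union>i. A i)"
      by (intro suminf_le_const) auto
    have "ennreal (\<nu> B) \<le> (suminf (\<lambda>i. \<phi> (A i)))" if B: "B \<in> sets M" "B \<subseteq> (\<Union>i. A i)" for B
    proof -
      have "range (\<lambda>i. B \<inter> A i) \<subseteq> sets M" "disjoint_family (\<lambda>i. B \<inter> A i)"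
        using A B by (auto simp: disjoint_family_on_def)
      moreover have "(\<Union>i. B \<inter> A i) = B" using B by auto
      ultimately have "(\<lambda>i. \<nu> (B \<inter> A i)) sums \<nu> B"
        using \<nu>[unfolded signed_measure_def, rule_format, of "\<lambda>i. B \<inter> A i"] by simp
      then have "(\<lambda>n. ennreal (\<Sum>i<n. \<nu> (B \<inter> A i))) \<longlonglongrightarrow> ennreal (\<nu> B)"
        unfolding sums_def by (rule tendsto_ennrealI)
      moreover have "ennreal (\<Sum>i<n. \<nu> (B \<inter> A i)) \<le> (suminf (\<lambda>i. \<phi> (A i)))" for n
      proof -
        have "ennreal (\<Sum>i<n. \<nu> (B \<inter> A i)) \<le> ennreal (\<Sum>i<n. max 0 (\<nu> (B \<inter> A i)))"
          by (intro ennreal_leI sum_mono) auto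
        also have "\<dots> = (\<Sum>i<n. ennreal (\<nu> (B \<inter> A i)))"
        proof -
          have max: "ennreal (max 0 x) = ennreal x" for x :: real
            by (cases "x \<ge> 0") (auto simp: max_def ennreal_neg)
          have "(\<Sum>i<n. ennreal (max 0 (\<nu> (B \<inter> A i)))) =
              ennreal (\<Sum>i<n. max 0 (\<nu> (B \<inter> A i)))"
            by (rule sum_ennreal) simp
          then show ?thesis by (simp only: max)
        qed
        also have "\<dots> \<le> (\<Sum>i<n. \<phi> (A i))"
          using A B by (intro sum_mono up) auto
        also have "\<dots> \<le> (suminf (\<lambda>i. \<phi> (A i)))" by (intro sum_le_suminf) auto
        finally show ?thesis .
      qed
      ultimately show ?thesis by (intro LIMSEQ_le_const2) auto
    qed
    then have "\<phi> (\<Union>i. A i) \<le> (suminf (\<lambda>i. \<phi> (A i)))"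
      unfolding \<phi>_def[THEN fun_cong, of "\<Union>i. A i"] by (intro SUP_least) auto
    with ge show "(suminf (\<lambda>i. \<phi> (A i))) = \<phi> (\<Union> (range A))" by (rule antisym)
  qed
  then have "measure_space (space M) (sets M) \<phi>"
    by (simp add: measure_space_def sets.sigma_algebra_axioms positive_def empty)
  then have "emeasure (upper_variation M \<nu>) A = \<phi> A"
    using emeasure_measure_of_sigma[of "space M" "sets M" \<phi> A] A
    by (simp add: measure_space_def upper_variation_def \<phi>_def)
  then show ?thesis by (simp add: \<phi>_def)
qed

abbreviation borel_upto :: "real \<Rightarrow> real measure" where
  "borel_upto T \<equiv> restrict_space borel {0..T}"

definition Sym_measure :: "nat \<Rightarrow> real \<Rightarrow> (real set \<Rightarrow> ('d::finite list \<Rightarrow> real)) \<Rightarrow> bool" where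
  "Sym_measure p T \<mu> \<longleftrightarrow>
     (\<forall>A \<in> sets (borel_upto T). \<mu> A \<in> Sym p) \<and>
     (\<forall>I. signed_measure (borel_upto T) (\<lambda>A. \<mu> A I))"

definition no_atoms :: "real \<Rightarrow> (real set \<Rightarrow> ('d::finite list \<Rightarrow> real)) \<Rightarrow> bool" where
  "no_atoms T \<mu> \<longleftrightarrow> (\<forall>t \<in> {0..T}. \<mu> {t} = (\<lambda>_. 0))"

text \<open>\<open>\<integral>\<^sub>0\<^sup>t \<langle>G, d\<mu>\<rangle>\<close> for a \<open>p\<close>-tensor valued \<open>G\<close>; the inner product is taken coordinatewise.\<close>

definition tensor_integral ::
    "nat \<Rightarrow> real \<Rightarrow> (real set \<Rightarrow> ('d::finite list \<Rightarrow> real)) \<Rightarrow> real \<Rightarrow>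
      (real \<Rightarrow> ('d list \<Rightarrow> real)) \<Rightarrow> real" where
  "tensor_integral p T \<mu> t G =
     (\<Sum>I | length I = p.
        signed_integral (borel_upto T) (\<lambda>A. \<mu> A I) (\<lambda>s. indicator {0..t} s * G s I))"


section \<open>The \<open>p\<close>-th variation\<close>

text \<open>Continuity of the polynomial-valued map \<open>g\<close> is continuity of its coefficients.\<close>

definition pth_variation_measure ::
    "nat \<Rightarrow> real \<Rightarrow> (nat \<Rightarrow> real set) \<Rightarrow> (real \<Rightarrow> real ^ 'd::finite) \<Rightarrow>
      (real set \<Rightarrow> ('d list \<Rightarrow> real)) \<Rightarrow> bool" where
  "pth_variation_measure p T \<pi> S \<mu> \<longleftrightarrow>
     Sym_measure p T \<mu> \<and> no_atoms T \<mu> \<and>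
     (\<forall>g. (\<forall>t \<in> {0..T}. g t \<in> homogeneous p) \<and>
          (\<forall>M. continuous_on {0..T} (\<lambda>t. Poly_Mapping.lookup (g t) M)) \<longrightarrow>
        (\<lambda>n. \<Sum>(a, b) \<in> intervals (\<pi> n). poly_pairing p (g a) (tensor_power p (S b - S a)))
          \<longlonglongrightarrow> tensor_integral p T \<mu> T (\<lambda>t. poly_tensor p (g t)))"

definition Vp :: "nat \<Rightarrow> real \<Rightarrow> (nat \<Rightarrow> real set) \<Rightarrow> (real \<Rightarrow> real ^ 'd::finite) set" where
  "Vp p T \<pi> = {S. continuous_on {0..T} S \<and> (\<lambda>n. osc S (\<pi> n)) \<longlonglongrightarrow> 0 \<and>
                  (\<exists>\<mu>. pth_variation_measure p T \<pi> S \<mu>)}"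

text \<open>The measure \<open>\<mu>\<^sub>S\<close> is determined on the Borel subsets of \<open>[0,T]\<close>, since its integrals against
  all continuous functions are; its values on other sets play no role.\<close>

definition mu_S :: "nat \<Rightarrow> real \<Rightarrow> (nat \<Rightarrow> real set) \<Rightarrow> (real \<Rightarrow> real ^ 'd::finite) \<Rightarrow>
    (real set \<Rightarrow> ('d list \<Rightarrow> real))" where
  "mu_S p T \<pi> S = (SOME \<mu>. pth_variation_measure p T \<pi> S \<mu>)"

text \<open>\<open>\<integral>\<^sub>0\<^sup>t \<langle>G(s), d[S]\<^sup>p(s)\<rangle>\<close>, where \<open>[S]\<^sup>p(t) = \<mu>\<^sub>S([0,t])\<close>.\<close>

definition pth_variation_integral ::
    "nat \<Rightarrow> real \<Rightarrow> (nat \<Rightarrow> real set) \<Rightarrow> (real \<Rightarrow> real ^ 'd::finite) \<Rightarrow> real \<Rightarrow>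
      (real \<Rightarrow> ('d list \<Rightarrow> real)) \<Rightarrow> real" where
  "pth_variation_integral p T \<pi> S t G = tensor_integral p T (mu_S p T \<pi> S) t G"


section \<open>Compensated Riemann sums\<close>

definition compensated_sum ::
    "nat \<Rightarrow> real set \<Rightarrow> (real \<Rightarrow> real ^ 'd::finite) \<Rightarrow> (real ^ 'd \<Rightarrow> real) \<Rightarrow> real \<Rightarrow> real" where
  "compensated_sum p P S f t =
     (\<Sum>(a, b) \<in> intervals P. \<Sum>k = 1..p - 1.
        1 / fact k * tensor_inner k (nabla k f (S a)) (tensor_power k (S (min b t) - S (min a t))))"

definition rough_integral ::
    "nat \<Rightarrow> (nat \<Rightarrow> real set) \<Rightarrow> (real \<Rightarrow> real ^ 'd::finite) \<Rightarrow> (real ^ 'd \<Rightarrow> real) \<Rightarrow> real \<Rightarrow> real"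
  where "rough_integral p \<pi> S f t = lim (\<lambda>n. compensated_sum p (\<pi> n) S f t)"

end

theory Submission
  imports Defs
begin

text \<open>Taylor expansion of order \<open>p\<close> on each partition interval, stopped at \<open>t\<close>, telescopes to the
  compensated sum plus \<open>1/p!\<close> times a weighted sum of \<open>p\<close>-th powers of increments plus a remainder.
  The remainder vanishes by uniform continuity of the \<open>p\<close>-th derivatives, because the sums of the
  absolute \<open>p\<close>-th powers converge (\<open>p\<close> is even) and hence are bounded. The weighted sums stopped at
  \<open>t\<close> converge to the integral over \<open>[0,t]\<close>, because the indicator of \<open>[0,t]\<close> can be approximated
  by continuous functions up to an error concentrated at the point \<open>t\<close>, which is not an atom.\<close>

section \<open>Sums over the intervals of a partition\<close>

lemma finite_intervals: "finite P \<Longrightarrow> finite (intervals P)"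
  by (rule finite_subset[of _ "P \<times> P"]) (auto simp: intervals_def)

lemma intervalsD:
  assumes "is_partition T P" "(a, b) \<in> intervals P"
  shows "a \<in> {0..T}" "b \<in> {0..T}" "a < b" "{a..b} \<subseteq> {0..T}"
  using assms by (auto simp: is_partition_def intervals_def)

text \<open>Lets a partition be built from left to right: a point beyond all others cannot cut an
  old interval, and the only new interval starts at the former maximum.\<close>

lemma intervals_insert_max:
  assumes "finite A" "A \<noteq> {}" "\<And>x. x \<in> A \<Longrightarrow> x < b"
  shows "intervals (insert b A) = insert (Max A, b) (intervals A)"
proof (intro set_eqI iffI; clarify)
  fix x y assume xy: "(x, y) \<in> intervals (insert b A)" "(x, y) \<notin> intervals A"
  have "x \<in> A" "y = b"
    using xy assms(3) by (force simp: intervals_def)+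
  moreover have "\<not> x < Max A"
  proof
    assume "x < Max A"
    then have "Max A \<in> insert b A \<inter> {x<..<b}"
      using Max_in[OF assms(1,2)] assms(3) by auto
    then show False using xy(1) \<open>y = b\<close> by (auto simp: intervals_def)
  qed
  ultimately show "x = Max A \<and> y = b"
    using Max_ge[OF assms(1)] by force
next
  fix x y assume xy: "(x, y) \<in> insert (Max A, b) (intervals A)"
  show "(x, y) \<in> intervals (insert b A)"
  proof (cases "(x, y) \<in> intervals A")
    case True
    then show ?thesis using assms(3) by (force simp: intervals_def)
  next
    case False
    then have "x = Max A" "y = b" using xy by auto
    then show ?thesis
      using Max_in[OF assms(1,2)] Max_ge[OF assms(1)] assms(3) by (force simp: intervals_def)
  qed
qed

lemma sum_intervals_telescope:
  fixes u :: "real \<Rightarrow> 'a::ab_group_add"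
  assumes "finite P" "P \<noteq> {}"
  shows "(\<Sum>(a, b) \<in> intervals P. u b - u a) = u (Max P) - u (Min P)"
  using assms
proof (induction P rule: finite_linorder_max_induct)
  case (insert b A)
  show ?case
  proof (cases "A = {}")
    case True
    then have "intervals (insert b A) = {}" by (auto simp: intervals_def)
    then show ?thesis using True by simp
  next
    case False
    have "(Max A, b) \<notin> intervals A"
      using insert.hyps by (auto simp: intervals_def)
    then have "(\<Sum>(x, y) \<in> intervals (insert b A). u y - u x)
        = (u b - u (Max A)) + (u (Max A) - u (Min A))"
      using insert False by (simp add: intervals_insert_max finite_intervals)
    moreover have "Max (insert b A) = b"
      using insert.hyps by (intro Max_eqI) (auto intro: less_imp_le)
    moreover have "Min (insert b A) = Min A"
      using insert.hyps False Min_in[of A] by (simp add: min_absorb2 less_imp_le)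
    ultimately show ?thesis by simp
  qed
qed simp

lemma sum_partition_telescope:
  fixes u :: "real \<Rightarrow> 'a::ab_group_add"
  assumes "is_partition T P"
  shows "(\<Sum>(a, b) \<in> intervals P. u b - u a) = u T - u 0"
proof -
  have "Max P = T" "Min P = 0"
    using assms by (auto simp: is_partition_def intro!: Max_eqI Min_eqI)
  moreover have "finite P" "P \<noteq> {}" using assms by (auto simp: is_partition_def)
  ultimately show ?thesis using sum_intervals_telescope[of P u] by simp
qed

text \<open>Bounds the cost of stopping at time t. Taken half-open, at most one interval contains t,
  even when t is itself a partition point.\<close>

lemma sum_straddling_le:
  assumes "finite P" "c \<ge> 0"
  shows "(\<Sum>(a, b) \<in> intervals P. if a \<le> t \<and> t < b then c else 0) \<le> (c::real)"
proof -
  let ?E = "{x \<in> intervals P. fst x \<le> t \<and> t < snd x}"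
  \<comment> \<open>If the left endpoints differ, say \<open>a < c\<close>, then
    \<open>c \<le> t < b\<close> puts c strictly inside \<open>(a, b)\<close>; unequal right
    endpoints are excluded likewise.\<close>
  have "x = y" if "x \<in> ?E" "y \<in> ?E" for x y
  proof -
    obtain a b c d where xy: "x = (a, b)" "y = (c, d)" by (cases x, cases y)
    have "\<not> a < c" "\<not> c < a" "\<not> b < d" "\<not> d < b"
      using that unfolding xy intervals_def by fastforce+
    then show ?thesis using xy by simp
  qed
  then have "card ?E \<le> 1"
    using finite_intervals[OF assms(1)] by (subst One_nat_def, subst card_le_Suc0_iff_eq) auto
  have "(\<Sum>(a, b) \<in> intervals P. if a \<le> t \<and> t < b then c else 0) = (\<Sum>x \<in> ?E. c)"
    using finite_intervals[OF assms(1)]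
    by (subst sum.inter_filter) (auto intro!: sum.cong simp: split_def)
  also have "\<dots> \<le> 1 * c"
    using \<open>card ?E \<le> 1\<close> assms(2) by (simp add: mult_left_le_one_le)
  finally show ?thesis by simp
qed

section \<open>Continuous paths: boundedness and oscillation\<close>

lemma continuous_on_interval_obtain_bound:
  fixes f :: "real \<Rightarrow> 'a::real_normed_vector"
  assumes "continuous_on {a..b} f"
  obtains K where "\<And>x. x \<in> {a..b} \<Longrightarrow> norm (f x) \<le> K"
proof -
  have "bounded (f ` {a..b})"
    by (intro compact_imp_bounded compact_continuous_image assms compact_Icc)
  then show thesis using that unfolding bounded_iff by (metis imageI)
qed

text \<open>Continuity bounds the increments, so the supremum over one interval is a genuine upper
  bound; finiteness of the partition does the same for the maximum.\<close>

lemma norm_diff_le_osc: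
  fixes S :: "real \<Rightarrow> 'a::real_normed_vector"
  assumes P: "is_partition T P" and S: "continuous_on {0..T} S"
    and ab: "(a, b) \<in> intervals P" and rs: "r \<in> {a..b}" "s \<in> {a..b}"
  shows "norm (S s - S r) \<le> osc S P"
proof -
  obtain K where K: "\<And>x. x \<in> {a..b} \<Longrightarrow> norm (S x) \<le> K"
    using continuous_on_interval_obtain_bound[OF continuous_on_subset[OF S intervalsD(4)[OF P ab]]]
    by blast
  have "norm (S y - S x) \<le> K + K" if "x \<in> {a..b}" "y \<in> {a..b}" for x y
    using K[OF that(1)] K[OF that(2)] norm_triangle_ineq4[of "S y" "S x"] by simp
  then have "bdd_above ((\<lambda>(r, s). norm (S s - S r)) ` ({a..b} \<times> {a..b}))"
    by (intro bdd_aboveI[of _ "K + K"]) auto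
  then have "norm (S s - S r) \<le> (SUP (r, s) \<in> {a..b} \<times> {a..b}. norm (S s - S r))"
    by (rule cSUP_upper2[where x = "(r, s)"]) (use rs in auto)
  also have "\<dots> \<le> osc S P"
    unfolding osc_def using P
    by (intro Max_ge image_eqI[OF _ ab]) (auto simp: finite_intervals is_partition_def)
  finally show ?thesis .
qed


section \<open>Integration against signed measures\<close>

lemma space_upper_variation [simp]: "space (upper_variation M \<nu>) = space M"
  and sets_upper_variation [simp, measurable_cong]: "sets (upper_variation M \<nu>) = sets M"
  by (simp_all add: upper_variation_def space_measure_of_conv sets.sigma_sets_eq)

lemma signed_measure_uminus: "signed_measure M \<nu> \<Longrightarrow> signed_measure M (\<lambda>A. - \<nu> A)"
  by (auto simp: signed_measure_def intro!: sums_minus)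

lemma upper_variation_cong:
  "(\<And>A. A \<in> sets M \<Longrightarrow> \<nu> A = \<nu>' A) \<Longrightarrow> upper_variation M \<nu> = upper_variation M \<nu>'"
  by (simp add: upper_variation_def)

lemma signed_integral_cong_measure:
  assumes "\<And>A. A \<in> sets M \<Longrightarrow> \<nu> A = \<nu>' A"
  shows "signed_integral M \<nu> h = signed_integral M \<nu>' h"
proof -
  have "upper_variation M \<nu> = upper_variation M \<nu>'"
    "upper_variation M (\<lambda>A. - \<nu> A) = upper_variation M (\<lambda>A. - \<nu>' A)"
    using assms by (auto intro!: upper_variation_cong)
  then show ?thesis by (simp add: signed_integral_def)
qed

text \<open>If the variation of a set were infinite, one could split off a piece of measure at least 1
  in absolute value and leave a piece of infinite variation. Iterating gives disjoint sets whose
  measures do not tend to 0.\<close>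

lemma finite_measure_upper_variation:
  assumes \<nu>: "signed_measure M \<nu>"
  shows "finite_measure (upper_variation M \<nu>)"
proof (rule ccontr)
  let ?U = "upper_variation M \<nu>"
  assume "\<not> ?thesis"
  then have inf: "emeasure ?U (space M) = \<infinity>"
    by (metis finite_measureI space_upper_variation)
  have step: "\<exists>E'. (E' \<in> sets M \<and> emeasure ?U E' = \<infinity>) \<and> E' \<subseteq> E \<and> \<bar>\<nu> (E - E')\<bar> \<ge> 1"
    if E: "E \<in> sets M \<and> emeasure ?U E = \<infinity>" for E
  proof -
    \<comment> \<open>The margin \<open>\<bar>\<nu> E\<bar> + 1\<close> makes both
      \<open>\<nu> B\<close> and \<open>\<nu> E - \<nu> B\<close> exceed 1 in absolute value. Either
      piece may thus be split off, and the one kept can be chosen with infinite variation.\<close>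
    have "ennreal (\<bar>\<nu> E\<bar> + 1) < (SUP B \<in> {B \<in> sets M. B \<subseteq> E}. ennreal (\<nu> B))"
      using E emeasure_upper_variation[OF \<nu>, of E] by simp
    then obtain B where B: "B \<in> sets M" "B \<subseteq> E" "ennreal (\<bar>\<nu> E\<bar> + 1) < ennreal (\<nu> B)"
      unfolding less_SUP_iff by auto
    then have big: "\<bar>\<nu> E\<bar> + 1 < \<nu> B"
      by (metis abs_ge_zero add_nonneg_nonneg ennreal_less_iff zero_le_one)
    have EB: "E - B \<in> sets M" using B E by auto
    have split: "\<nu> E = \<nu> B + \<nu> (E - B)"
      using signed_measure_Un[OF \<nu>, of B "E - B"] B E EB by (simp add: Un_absorb1)
    have "emeasure ?U B + emeasure ?U (E - B) = \<infinity>"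
      using plus_emeasure[of B ?U "E - B"] B E EB by (simp add: Un_absorb1)
    then consider "emeasure ?U B = \<infinity>" | "emeasure ?U (E - B) = \<infinity>"
      by (auto simp: infinity_ennreal_def ennreal_add_eq_top)
    then show ?thesis
    proof cases
      case 1
      then show ?thesis using B big split by (intro exI[of _ B]) auto
    next
      case 2
      have "E - (E - B) = B" using B by auto
      then show ?thesis using B E big split 2 by (intro exI[of _ "E - B"]) auto
    qed
  qed
  obtain E where E: "\<And>n. E n \<in> sets M" "\<And>n. E (Suc n) \<subseteq> E n" "\<And>n. \<bar>\<nu> (E n - E (Suc n))\<bar> \<ge> 1"
    using dependent_nat_choice[of "\<lambda>_ E. E \<in> sets M \<and> emeasure ?U E = \<infinity>"
        "\<lambda>_ E E'. E' \<subseteq> E \<and> \<bar>\<nu> (E - E')\<bar> \<ge> 1"] step inf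
    by (metis sets.top)
  define A where "A n = E n - E (Suc n)" for n
  have "decseq E" using E(2) by (rule decseq_SucI)
  have "A m \<inter> A n = {}" if "m < n" for m n
    using decseqD[OF \<open>decseq E\<close>, of "Suc m" n] that by (auto simp: A_def)
  then have "disjoint_family A"
    unfolding disjoint_family_on_def by (metis inf_commute linorder_neqE_nat)
  moreover have "range A \<subseteq> sets M" using E(1) by (auto simp: A_def)
  ultimately have "(\<lambda>n. \<nu> (A n)) \<longlonglongrightarrow> 0"
    using \<nu> unfolding signed_measure_def by (metis sums_summable summable_LIMSEQ_zero)
  then have "eventually (\<lambda>n. \<bar>\<nu> (A n)\<bar> < 1) sequentially"
    using tendstoD[of "\<lambda>n. \<nu> (A n)" 0 sequentially 1] by (simp add: dist_real_def)
  then show False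
    using E(3) by (auto simp: A_def eventually_sequentially not_less[symmetric])
qed

text \<open>Both variations of the Jordan decomposition are finite measures, so the constant K is an
  integrable dominating function for each.\<close>

lemma signed_integral_dominated_convergence:
  assumes \<nu>: "signed_measure M \<nu>"
    and meas: "h \<in> borel_measurable M" "\<And>n. H n \<in> borel_measurable M"
    and lim: "\<And>x. x \<in> space M \<Longrightarrow> (\<lambda>n. H n x) \<longlonglongrightarrow> h x"
    and bound: "\<And>n x. x \<in> space M \<Longrightarrow> \<bar>H n x\<bar> \<le> K"
  shows "(\<lambda>n. signed_integral M \<nu> (H n)) \<longlonglongrightarrow> signed_integral M \<nu> h"
proof -
  have "(\<lambda>n. integral\<^sup>L (upper_variation M \<nu>') (H n)) \<longlonglongrightarrow> integral\<^sup>L (upper_variation M \<nu>') h"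
    if "signed_measure M \<nu>'" for \<nu>'
  proof -
    interpret finite_measure "upper_variation M \<nu>'"
      by (rule finite_measure_upper_variation[OF that])
    show ?thesis
    proof (rule integral_dominated_convergence[where w = "\<lambda>_. K"])
      show "h \<in> borel_measurable (upper_variation M \<nu>')"
        "\<And>n. H n \<in> borel_measurable (upper_variation M \<nu>')"
        using meas by (simp_all cong: measurable_cong_sets)
    qed (use lim bound in auto)
  qed
  from this[OF \<nu>] this[OF signed_measure_uminus[OF \<nu>]] show ?thesis
    unfolding signed_integral_def by (rule tendsto_diff)
qed

text \<open>The only subsets of \<open>{t}\<close> are \<open>{}\<close> and \<open>{t}\<close>, so
  both upper variations give \<open>{t}\<close> mass 0, and h vanishes almost everywhere for
  each.\<close>

lemma signed_integral_null_point:
  assumes \<nu>: "signed_measure M \<nu>" and t: "{t} \<in> sets M" "\<nu> {t} = 0"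
    and h: "\<And>x. x \<in> space M \<Longrightarrow> x \<noteq> t \<Longrightarrow> h x = 0"
  shows "signed_integral M \<nu> h = 0"
proof -
  have "integral\<^sup>L (upper_variation M \<nu>') h = 0"
    if \<nu>': "signed_measure M \<nu>'" "\<nu>' {t} = 0" for \<nu>'
  proof -
    have "ennreal (\<nu>' B) = 0" if "B \<subseteq> {t}" for B
      using that \<nu>'(2) signed_measure_empty[OF \<nu>'(1)] by (auto simp: subset_singleton_iff)
    then have "(SUP B \<in> {B \<in> sets M. B \<subseteq> {t}}. ennreal (\<nu>' B)) \<le> 0"
      by (intro SUP_least) simp
    then have "{t} \<in> null_sets (upper_variation M \<nu>')"
      using emeasure_upper_variation[OF \<nu>'(1) t(1)] t(1) by (intro null_setsI) auto
    then have "AE x in upper_variation M \<nu>'. h x = 0"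
      by (rule AE_I'[of "{t}"]) (use h in auto)
    then show ?thesis by (rule integral_eq_zero_AE)
  qed
  from this[OF \<nu> t(2)] this[OF signed_measure_uminus[OF \<nu>]] t(2) show ?thesis
    by (simp add: signed_integral_def)
qed


section \<open>Limits of weighted sums of monomials\<close>

lemma abs_monomial_le:
  fixes v :: "real ^ 'd"
  assumes "\<And>i. \<bar>v $ i\<bar> \<le> c"
  shows "\<bar>\<Prod>i\<leftarrow>I. v $ i\<bar> \<le> c ^ length I"
proof (induction I)
  case (Cons i I)
  have "c \<ge> 0" using assms[of i] by linarith
  then show ?case using Cons assms[of i] by (simp add: abs_mult mult_mono)
qed simp

text \<open>Every factor is at most the largest coordinate in absolute value, and its even power is
  one of the nonnegative summands. The right side is free of absolute values, so its sums over a
  partition are covered by the definition of the p-th variation.\<close>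

lemma abs_monomial_le_sum_powers:
  fixes v :: "real ^ 'd::finite"
  assumes "even (length I)"
  shows "\<bar>\<Prod>i\<leftarrow>I. v $ i\<bar> \<le> (\<Sum>i\<in>UNIV. (v $ i) ^ length I)"
proof -
  define c where "c = Max (range (\<lambda>i. \<bar>v $ i\<bar>))"
  have "c \<in> range (\<lambda>i. \<bar>v $ i\<bar>)"
    unfolding c_def by (rule Max_in) auto
  then obtain j where j: "c = \<bar>v $ j\<bar>" by blast
  have "\<bar>\<Prod>i\<leftarrow>I. v $ i\<bar> \<le> c ^ length I"
    by (rule abs_monomial_le) (simp add: c_def)
  also have "\<dots> = (v $ j) ^ length I"
    using assms by (simp add: j power_even_abs)
  also have "\<dots> \<le> (\<Sum>i\<in>UNIV. (v $ i) ^ length I)"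
    using assms by (intro member_le_sum) (auto simp: zero_le_even_power)
  finally show ?thesis .
qed

text \<open>Testing against polynomials with the single monomial of \<open>I\<close> decouples the components of
  \<open>\<mu>\<close>; as \<open>\<mu>\<close> is symmetric, the tensor of \<open>h \<cdot> X\<^sup>I\<close> integrates to the integral of \<open>h\<close>
  against the component \<open>I\<close>. Hence the symmetry of \<open>\<nabla>\<^sup>pf\<close> is never needed.\<close>

lemma monomial_sums_tendsto:
  fixes S :: "real \<Rightarrow> real ^ 'd::finite"
  assumes \<mu>: "pth_variation_measure p T \<pi> S \<mu>" and I: "length I = p"
    and h: "continuous_on {0..T} h"
  shows "(\<lambda>n. \<Sum>(a, b) \<in> intervals (\<pi> n). h a * (\<Prod>i\<leftarrow>I. (S b - S a) $ i))
    \<longlonglongrightarrow> signed_integral (borel_upto T) (\<lambda>A. \<mu> A I) (\<lambda>s. indicator {0..T} s * h s)"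
proof -
  define g where "g t = Poly_Mapping.single (mset I) (h t)" for t
  let ?c = "real (card {J. mset J = mset I})"
  let ?SI = "\<lambda>J. signed_integral (borel_upto T) (\<lambda>A. \<mu> A J)"
  have hom: "g t \<in> homogeneous p" for t
    using I by (auto simp: g_def homogeneous_def)
  have "continuous_on {0..T} (\<lambda>t. Poly_Mapping.lookup (g t) M)" for M
    using h by (cases "mset I = M") (simp_all add: g_def lookup_single)
  with hom \<mu> have lim: "(\<lambda>n. \<Sum>(a, b) \<in> intervals (\<pi> n). poly_pairing p (g a) (tensor_power p (S b - S a)))
      \<longlonglongrightarrow> tensor_integral p T \<mu> T (\<lambda>t. poly_tensor p (g t))"
    by (auto simp: pth_variation_measure_def)
  have pairing: "poly_pairing p (g a) (tensor_power p v) = h a * (\<Prod>i\<leftarrow>I. v $ i)" for a v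
    unfolding poly_pairing_tensor_power[OF hom]
    by (simp add: poly_eval_def g_def lookup_single flip: prod_mset_prod_list)
  have c: "?c \<noteq> 0" using finite_mset_eq[of "mset I"] by auto
  have sym: "?SI J k = ?SI I k" if "mset J = mset I" for J k
  proof (rule signed_integral_cong_measure)
    fix A assume "A \<in> sets (borel_upto T)"
    then have "\<mu> A \<in> Sym p"
      using \<mu> by (auto simp: pth_variation_measure_def Sym_measure_def)
    then show "\<mu> A J = \<mu> A I" using that unfolding Sym_def by blast
  qed
  \<comment> \<open>Each of the \<open>?c\<close> rearrangements of I contributes the same integral
    with weight \<open>1 / ?c\<close>, so summing over J returns exactly one copy.\<close>
  have component: "?SI J (\<lambda>s. indicator {0..T} s * poly_tensor p (g s) J)
      = (if mset J = mset I then ?SI I (\<lambda>s. indicator {0..T} s * h s) / ?c else 0)"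
    if "length J = p" for J
  proof (cases "mset J = mset I")
    case True
    have "?SI I (\<lambda>s. indicator {0..T} s * poly_tensor p (g s) J)
        = ?SI I (\<lambda>s. indicator {0..T} s * h s / ?c)"
      using that True by (simp add: poly_tensor_def g_def lookup_single)
    then show ?thesis
      using True sym[OF True] by (simp add: signed_integral_def diff_divide_distrib)
  next
    case False
    then have "poly_tensor p (g s) J = 0" for s
      by (simp add: poly_tensor_def g_def lookup_single_not_eq)
    then show ?thesis
      using False by (simp add: signed_integral_def)
  qed
  have eq: "{J. length J = p} \<inter> {J. mset J = mset I} = {J. mset J = mset I}"
    using I by (auto dest: mset_eq_length)
  have "tensor_integral p T \<mu> T (\<lambda>t. poly_tensor p (g t))
      = (\<Sum>J | length J = p. if mset J = mset I then ?SI I (\<lambda>s. indicator {0..T} s * h s) / ?c else 0)"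
    unfolding tensor_integral_def by (intro sum.cong) (auto simp: component)
  also have "\<dots> = ?SI I (\<lambda>s. indicator {0..T} s * h s)"
    using c by (simp add: sum.If_cases finite_lists_length eq)
  finally show ?thesis using lim by (simp add: pairing)
qed

section \<open>From continuous weights to the indicator of \<open>[0,t]\<close>\<close>

lemma tendsto_by_approximation:
  fixes X :: "nat \<Rightarrow> real"
  assumes Y: "\<And>m. Y m \<longlonglongrightarrow> Y' m" "Y' \<longlonglongrightarrow> L"
    and Z: "\<And>m. Z m \<longlonglongrightarrow> Z' m" "Z' \<longlonglongrightarrow> 0"
    and XY: "\<And>m. eventually (\<lambda>n. \<bar>X n - Y m n\<bar> \<le> Z m n) sequentially"
  shows "X \<longlonglongrightarrow> L"
proof (rule tendstoI)
  fix \<epsilon> :: real assume "\<epsilon> > 0"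
  \<comment> \<open>Four errors share \<epsilon>: \<open>Y' m\<close> to L, \<open>Z' m\<close> to
    0, and for that fixed m, \<open>Y m n\<close> to \<open>Y' m\<close> and \<open>Z m n\<close> to
    \<open>Z' m\<close>.\<close>
  then have e: "\<epsilon> / 4 > 0" by simp
  have "eventually (\<lambda>m. dist (Y' m) L < \<epsilon> / 4 \<and> dist (Z' m) 0 < \<epsilon> / 4) sequentially"
    using tendstoD[OF Y(2) e] tendstoD[OF Z(2) e] by (rule eventually_conj)
  then obtain m where m: "dist (Y' m) L < \<epsilon> / 4" "dist (Z' m) 0 < \<epsilon> / 4"
    using eventually_happens'[OF sequentially_bot] by blast
  from tendstoD[OF Y(1)[of m] e] tendstoD[OF Z(1)[of m] e] XY[of m]
  show "eventually (\<lambda>n. dist (X n) L < \<epsilon>) sequentially"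
  proof eventually_elim
    case (elim n)
    then show ?case using m unfolding dist_real_def by linarith
  qed
qed

text \<open>With c the distance from a point to a closed set, these are cut-off functions of slope m
  decreasing to the indicator of that set.\<close>

lemma bump_tendsto:
  assumes "c \<ge> 0"
  shows "(\<lambda>m. max 0 (1 - real m * c)) \<longlonglongrightarrow> (if c = 0 then 1 else 0)"
proof (cases "c = 0")
  case False
  then have "c > 0" using assms by simp
  then obtain N where N: "1 < real N * c"
    using ex_less_of_nat_mult by blast
  have "max 0 (1 - real m * c) = 0" if "m \<ge> N" for m
  proof -
    have "real N * c \<le> real m * c" using that assms by (simp add: mult_right_mono)
    then show ?thesis using N by simp
  qed
  then have "eventually (\<lambda>m. max 0 (1 - real m * c) = 0) sequentially"
    unfolding eventually_sequentially by blast
  then show ?thesis using False by (simp add: tendsto_eventually)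
qed simp

text \<open>The indicator of \<open>[0,t]\<close> is squeezed between continuous functions. The approximation error
  is supported near \<open>t\<close>; it is controlled by the diagonal components of \<open>\<mu>\<close>, which dominate all
  others because \<open>p\<close> is even, and vanishes in the limit because \<open>\<mu>\<close> has no atom at \<open>t\<close>.\<close>

lemma truncated_monomial_sums_tendsto:
  fixes S :: "real \<Rightarrow> real ^ 'd::finite"
  assumes \<mu>: "pth_variation_measure p T \<pi> S \<mu>" and I: "length I = p" and p: "even p"
    and part: "\<And>n. n \<ge> 1 \<Longrightarrow> is_partition T (\<pi> n)"
    and h: "continuous_on {0..T} h" and t: "t \<in> {0..T}"
  shows "(\<lambda>n. \<Sum>(a, b) \<in> intervals (\<pi> n). indicator {..t} a * h a * (\<Prod>i\<leftarrow>I. (S b - S a) $ i))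
    \<longlonglongrightarrow> signed_integral (borel_upto T) (\<lambda>A. \<mu> A I) (\<lambda>s. indicator {0..t} s * h s)"
    (is "?X \<longlonglongrightarrow> ?L")
proof -
  \<comment> \<open>\<open>\<phi> m\<close> equals 1 up to t and then falls to 0 with slope m;
    \<open>\<psi> m\<close> is the tent of slope m centred at t and controls the error.\<close>
  define \<phi> where "\<phi> m s = max 0 (1 - real m * max 0 (s - t))" for m s
  define \<psi> where "\<psi> m s = max 0 (1 - real m * \<bar>s - t\<bar>)" for m s
  let ?SI = "\<lambda>J. signed_integral (borel_upto T) (\<lambda>A. \<mu> A J)"
  let ?D = "\<lambda>J a b. \<Prod>i\<leftarrow>J. (S b - S a) $ i"
  obtain K where K: "\<And>s. s \<in> {0..T} \<Longrightarrow> \<bar>h s\<bar> \<le> K"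
    using continuous_on_interval_obtain_bound[OF h] by auto
  have "K \<ge> 0" using K[OF t] by linarith
  have \<phi>: "0 \<le> \<phi> m s" "\<phi> m s \<le> 1" "continuous_on A (\<phi> m)" for m s A
    by (auto simp: \<phi>_def intro!: continuous_intros)
  have \<psi>: "0 \<le> \<psi> m s" "\<psi> m s \<le> 1" "continuous_on A (\<psi> m)" for m s A
    by (auto simp: \<psi>_def intro!: continuous_intros)
  have \<nu>: "signed_measure (borel_upto T) (\<lambda>A. \<mu> A J)" for J
    using \<mu> by (auto simp: pth_variation_measure_def Sym_measure_def)
  have meas: "(\<lambda>s. indicator B s * k s) \<in> borel_measurable (borel_upto T)"
    if "continuous_on {0..T} k" "B \<in> sets borel" for B and k :: "real \<Rightarrow> real"
  proof (rule borel_measurable_times)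
    show "(indicator B :: real \<Rightarrow> real) \<in> borel_measurable (borel_upto T)"
      using that(2) by (intro measurable_restrict_space1) simp
  qed (rule borel_measurable_continuous_on_restrict[OF that(1)])
  define Y where "Y m n = (\<Sum>(a, b) \<in> intervals (\<pi> n). (\<phi> m a * h a) * ?D I a b)" for m n
  define Y' where "Y' m = ?SI I (\<lambda>s. indicator {0..T} s * (\<phi> m s * h s))" for m
  \<comment> \<open>\<open>replicate p i\<close> is the multi-index of the pure power of the i-th
    coordinate, a diagonal component.\<close>
  define Z where "Z m n = K * (\<Sum>i\<in>UNIV. \<Sum>(a, b) \<in> intervals (\<pi> n). \<psi> m a * ?D (replicate p i) a b)" for m n
  define Z' where "Z' m = K * (\<Sum>i\<in>UNIV. ?SI (replicate p i) (\<lambda>s. indicator {0..T} s * \<psi> m s))" for m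
  show ?thesis
  proof (rule tendsto_by_approximation)
    show "Y m \<longlonglongrightarrow> Y' m" for m
      unfolding Y_def Y'_def
      by (rule monomial_sums_tendsto[OF \<mu> I]) (intro continuous_intros \<phi> h)
    show "Y' \<longlonglongrightarrow> ?L"
      unfolding Y'_def
    proof (rule signed_integral_dominated_convergence[OF \<nu>, where K = K])
      fix s assume s: "s \<in> space (borel_upto T)"
      then have s': "s \<in> {0..T}" by (simp add: space_restrict_space)
      have "(\<lambda>m. \<phi> m s) \<longlonglongrightarrow> (if max 0 (s - t) = 0 then 1 else 0)"
        unfolding \<phi>_def by (rule bump_tendsto) simp
      also have "(if max 0 (s - t) = 0 then 1 else 0) = (indicator {0..t} s :: real)"
        using s' by (auto simp: indicator_def)
      finally show "(\<lambda>m. indicator {0..T} s * (\<phi> m s * h s)) \<longlonglongrightarrow> indicator {0..t} s * h s"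
        using s' by (auto intro!: tendsto_mult)
      show "\<bar>indicator {0..T} s * (\<phi> m s * h s)\<bar> \<le> K" for m
        using \<phi>(1,2)[of m s] K[OF s'] s' mult_mono[of "\<phi> m s" 1 "\<bar>h s\<bar>" K] by (simp add: abs_mult)
    qed (intro meas continuous_intros \<phi> h; simp)+
    show "Z m \<longlonglongrightarrow> Z' m" for m
      unfolding Z_def Z'_def
      by (intro tendsto_mult tendsto_const tendsto_sum monomial_sums_tendsto[OF \<mu>] \<psi>) simp
    have "(\<lambda>m. ?SI J (\<lambda>s. indicator {0..T} s * \<psi> m s)) \<longlonglongrightarrow> 0" for J
    proof -
      \<comment> \<open>The tents shrink to the indicator of the single point t, which carries no
        mass.\<close>
      have "(\<lambda>m. ?SI J (\<lambda>s. indicator {0..T} s * \<psi> m s)) \<longlonglongrightarrow> ?SI J (\<lambda>s. indicator {t} s * 1)"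
      proof (rule signed_integral_dominated_convergence[OF \<nu>, where K = 1])
        fix s assume s: "s \<in> space (borel_upto T)"
        then have s': "s \<in> {0..T}" by (simp add: space_restrict_space)
        have "(\<lambda>m. \<psi> m s) \<longlonglongrightarrow> (if \<bar>s - t\<bar> = 0 then 1 else 0)"
          unfolding \<psi>_def by (rule bump_tendsto) simp
        then show "(\<lambda>m. indicator {0..T} s * \<psi> m s) \<longlonglongrightarrow> indicator {t} s * 1"
          using s' by (cases "s = t") simp_all
        show "\<bar>indicator {0..T} s * \<psi> m s\<bar> \<le> 1" for m
          using \<psi>(1,2)[of m s] s' by simp
      qed (intro meas continuous_intros \<psi>; simp)+
      moreover have "\<mu> {t} J = 0"
        using \<mu> t by (auto simp: pth_variation_measure_def no_atoms_def)
      moreover have "{t} \<in> sets (borel_upto T)"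
        using t by (auto simp: sets_restrict_space_iff)
      ultimately show ?thesis
        using signed_integral_null_point[OF \<nu>, of t J "\<lambda>s. indicator {t} s * 1"] by simp
    qed
    then have "(\<lambda>m. K * (\<Sum>i\<in>UNIV. ?SI (replicate p i) (\<lambda>s. indicator {0..T} s * \<psi> m s)))
        \<longlonglongrightarrow> K * (\<Sum>i\<in>(UNIV::'d set). 0)"
      by (intro tendsto_mult tendsto_const tendsto_sum)
    then show "Z' \<longlonglongrightarrow> 0" by (simp add: Z'_def[abs_def])
    have "\<bar>?X n - Y m n\<bar> \<le> Z m n" if "n \<ge> 1" for m n
    proof -
      have "?X n - Y m n = (\<Sum>(a, b) \<in> intervals (\<pi> n). (indicator {..t} a - \<phi> m a) * h a * ?D I a b)"
        unfolding Y_def sum_subtractf[symmetric]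
        by (intro sum.cong refl) (simp add: split_def left_diff_distrib right_diff_distrib mult_ac del: vector_minus_component)
      also have "\<bar>\<dots>\<bar> \<le> (\<Sum>(a, b) \<in> intervals (\<pi> n). K * (\<Sum>i\<in>UNIV. \<psi> m a * ?D (replicate p i) a b))"
      proof (rule sum_abs[THEN order_trans], rule sum_mono, clarify)
        fix a b assume "(a, b) \<in> intervals (\<pi> n)"
        then have a: "a \<in> {0..T}" using intervalsD[OF part[OF that]] by blast
        \<comment> \<open>For \<open>a \<le> t\<close> the left side is 0; for \<open>a > t\<close>
          both sides equal \<open>\<phi> m a\<close>.\<close>
        have "\<bar>indicator {..t} a - \<phi> m a\<bar> \<le> \<psi> m a"
          by (auto simp: \<phi>_def \<psi>_def indicator_def)
        moreover have "\<bar>?D I a b\<bar> \<le> (\<Sum>i\<in>UNIV. ?D (replicate p i) a b)"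
          using abs_monomial_le_sum_powers[of I "S b - S a"] I p
          by (simp add: map_replicate prod_list_replicate)
        ultimately have "\<bar>indicator {..t} a - \<phi> m a\<bar> * \<bar>h a\<bar> * \<bar>?D I a b\<bar>
            \<le> \<psi> m a * K * (\<Sum>i\<in>UNIV. ?D (replicate p i) a b)"
          using K[OF a] \<open>K \<ge> 0\<close> \<psi>(1)[of m a] by (intro mult_mono) auto
        then show "\<bar>(indicator {..t} a - \<phi> m a) * h a * ?D I a b\<bar>
            \<le> K * (\<Sum>i\<in>UNIV. \<psi> m a * ?D (replicate p i) a b)"
          by (simp add: abs_mult sum_distrib_left mult_ac)
      qed
      also have "\<dots> = Z m n"
        unfolding Z_def by (subst sum.swap) (simp add: sum_distrib_left split_def)
      finally show ?thesis .
    qed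
    then show "eventually (\<lambda>n. \<bar>?X n - Y m n\<bar> \<le> Z m n) sequentially" for m
      unfolding eventually_sequentially by blast
  qed
qed

text \<open>Stopping the path at \<open>t\<close> instead of truncating the weight only changes the interval that
  straddles \<open>t\<close>.\<close>

lemma stopped_monomial_sums_tendsto:
  fixes S :: "real \<Rightarrow> real ^ 'd::finite"
  assumes \<mu>: "pth_variation_measure p T \<pi> S \<mu>" and I: "length I = p" and p: "even p" "p > 0"
    and part: "\<And>n. n \<ge> 1 \<Longrightarrow> is_partition T (\<pi> n)"
    and S: "continuous_on {0..T} S" "(\<lambda>n. osc S (\<pi> n)) \<longlonglongrightarrow> 0"
    and h: "continuous_on {0..T} h" and t: "t \<in> {0..T}"
  shows "(\<lambda>n. \<Sum>(a, b) \<in> intervals (\<pi> n). h a * (\<Prod>i\<leftarrow>I. (S (min b t) - S (min a t)) $ i))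
    \<longlonglongrightarrow> signed_integral (borel_upto T) (\<lambda>A. \<mu> A I) (\<lambda>s. indicator {0..t} s * h s)"
    (is "?X \<longlonglongrightarrow> ?L")
    and "\<exists>B. eventually (\<lambda>n. (\<Sum>(a, b) \<in> intervals (\<pi> n).
      \<bar>\<Prod>i\<leftarrow>I. (S (min b t) - S (min a t)) $ i\<bar>) \<le> B) sequentially"
proof -
  let ?D = "\<lambda>a b. \<Prod>i\<leftarrow>I. (S b - S a) $ i"
  let ?E = "\<lambda>a b. \<Prod>i\<leftarrow>I. (S (min b t) - S (min a t)) $ i"
  let ?o = "\<lambda>n. osc S (\<pi> n)"
  define e where "e n a b = (if a \<le> t \<and> t < b then ?o n ^ p else 0)" for n a b
  have e_sum: "c * (\<Sum>(a, b) \<in> intervals (\<pi> n). e n a b) \<le> c * ?o n ^ p" if "n \<ge> 1" "c \<ge> 0" for n c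
    unfolding e_def
    using that part[OF that(1)] p by (intro mult_left_mono sum_straddling_le)
      (auto simp: is_partition_def zero_le_even_power)
  have small: "\<bar>\<Prod>i\<leftarrow>I. (S s - S r) $ i\<bar> \<le> ?o n ^ p"
    if "n \<ge> 1" "(a, b) \<in> intervals (\<pi> n)" "r \<in> {a..b}" "s \<in> {a..b}" for n a b r s
    unfolding I[symmetric]
    by (rule abs_monomial_le)
      (rule order_trans[OF component_le_norm_cart norm_diff_le_osc[OF part[OF that(1)] S(1) that(2-)]])
  \<comment> \<open>The stopped increment is 0, and \<open>p > 0\<close> makes the product
    nonempty.\<close>
  have after: "?E a b = 0" if "t < a" "a < b" for a b
    using that I p by (cases I) auto
  \<comment> \<open>The two monomials agree except on the interval straddling t, where each is at
    most the p-th power of the oscillation. An interval starting at t counts as straddling: its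
    indicator is 1 but its stopped increment is 0.\<close>
  have diff: "\<bar>?E a b - indicator {..t} a * ?D a b\<bar> \<le> 2 * e n a b"
    if "n \<ge> 1" and ab: "(a, b) \<in> intervals (\<pi> n)" for n a b
  proof -
    have "a < b" using ab by (simp add: intervals_def)
    consider "t < a" | "b \<le> t" | "a \<le> t" "t < b" by linarith
    then show ?thesis
    proof cases
      case 1
      then show ?thesis using after \<open>a < b\<close> by (simp add: e_def)
    next
      case 2
      then show ?thesis using \<open>a < b\<close> by (simp add: e_def min_absorb1)
    next
      case 3
      then have "\<bar>?E a b\<bar> \<le> ?o n ^ p" "\<bar>?D a b\<bar> \<le> ?o n ^ p"
        using small[OF that, of a t] small[OF that, of a b] \<open>a < b\<close>
        by (simp_all add: min_absorb1 min_absorb2)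
      then show ?thesis using 3 by (simp add: e_def abs_le_iff)
    qed
  qed
  obtain K where K: "\<And>s. s \<in> {0..T} \<Longrightarrow> \<bar>h s\<bar> \<le> K"
    using continuous_on_interval_obtain_bound[OF h] by auto
  have "K \<ge> 0" using K[OF t] by linarith
  let ?Y = "\<lambda>n. \<Sum>(a, b) \<in> intervals (\<pi> n). indicator {..t} a * h a * ?D a b"
  have "\<bar>?X n - ?Y n\<bar> \<le> 2 * K * ?o n ^ p" if "n \<ge> 1" for n
  proof -
    have "?X n - ?Y n = (\<Sum>(a, b) \<in> intervals (\<pi> n). h a * (?E a b - indicator {..t} a * ?D a b))"
      unfolding sum_subtractf[symmetric] by (intro sum.cong refl) (simp add: split_def right_diff_distrib mult_ac del: vector_minus_component)
    also have "\<bar>\<dots>\<bar> \<le> (\<Sum>(a, b) \<in> intervals (\<pi> n). K * (2 * e n a b))"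
    proof (rule sum_abs[THEN order_trans], rule sum_mono, clarify)
      fix a b assume ab: "(a, b) \<in> intervals (\<pi> n)"
      then have "a \<in> {0..T}" using intervalsD[OF part[OF that]] by blast
      then show "\<bar>h a * (?E a b - indicator {..t} a * ?D a b)\<bar> \<le> K * (2 * e n a b)"
        unfolding abs_mult using K diff[OF that ab] \<open>K \<ge> 0\<close>
        by (intro mult_mono) (auto simp del: vector_minus_component)
    qed
    also have "\<dots> = 2 * K * (\<Sum>(a, b) \<in> intervals (\<pi> n). e n a b)"
      by (simp add: sum_distrib_left split_def mult_ac)
    also have "\<dots> \<le> 2 * K * ?o n ^ p"
      using \<open>K \<ge> 0\<close> by (intro e_sum that) simp
    finally show ?thesis .
  qed
  moreover have osc_p: "(\<lambda>n. ?o n ^ p) \<longlonglongrightarrow> 0"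
    using tendsto_power[OF S(2), of p] p(2) by (simp add: zero_power)
  then have "(\<lambda>n. 2 * K * ?o n ^ p) \<longlonglongrightarrow> 0"
    using tendsto_mult_right_zero by blast
  ultimately have "(\<lambda>n. ?X n - ?Y n) \<longlonglongrightarrow> 0"
    by (rule_tac Lim_null_comparison) (auto simp: eventually_sequentially)
  moreover have "?Y \<longlonglongrightarrow> ?L"
    by (rule truncated_monomial_sums_tendsto[OF \<mu> I p(1) part h t])
  ultimately have "(\<lambda>n. (?X n - ?Y n) + ?Y n) \<longlonglongrightarrow> 0 + ?L"
    by (rule tendsto_add)
  then show "?X \<longlonglongrightarrow> ?L" by simp

  \<comment> \<open>The absolute monomials are dominated by the diagonal powers of the full
    increments, plus the straddling error. With weight 1 the diagonal sums converge to q, so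
    \<open>q + 1\<close> is eventually a bound.\<close>
  let ?Q = "\<lambda>n. \<Sum>i\<in>UNIV. \<Sum>(a, b) \<in> intervals (\<pi> n). 1 * (\<Prod>i\<leftarrow>replicate p i. (S b - S a) $ i)"
  define q where "q = (\<Sum>i\<in>UNIV. signed_integral (borel_upto T) (\<lambda>A. \<mu> A (replicate p i))
    (\<lambda>s. indicator {0..T} s * 1))"
  have "?Q \<longlonglongrightarrow> q"
    unfolding q_def
    by (intro tendsto_sum monomial_sums_tendsto[OF \<mu>] continuous_on_const) simp
  then have lim: "(\<lambda>n. ?Q n + 2 * ?o n ^ p) \<longlonglongrightarrow> q + 0"
    using osc_p tendsto_mult_right_zero by (intro tendsto_add) blast
  have le: "(\<Sum>(a, b) \<in> intervals (\<pi> n). \<bar>?E a b\<bar>) \<le> ?Q n + 2 * ?o n ^ p" if "n \<ge> 1" for n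
  proof -
    have "(\<Sum>(a, b) \<in> intervals (\<pi> n). \<bar>?E a b\<bar>)
      \<le> (\<Sum>(a, b) \<in> intervals (\<pi> n). (\<Sum>i\<in>UNIV. (S b - S a) $ i ^ p) + 2 * e n a b)"
    proof (rule sum_mono, clarify)
      fix a b assume ab: "(a, b) \<in> intervals (\<pi> n)"
      have "\<bar>?E a b\<bar> \<le> \<bar>indicator {..t} a * ?D a b\<bar> + 2 * e n a b"
        using diff[OF that ab] by linarith
      also have "\<bar>indicator {..t} a * ?D a b\<bar> \<le> \<bar>?D a b\<bar>" by (simp add: indicator_def)
      also have "\<bar>?D a b\<bar> \<le> (\<Sum>i\<in>UNIV. (S b - S a) $ i ^ p)"
        using abs_monomial_le_sum_powers[of I "S b - S a"] I p by simp
      finally show "\<bar>?E a b\<bar> \<le> (\<Sum>i\<in>UNIV. (S b - S a) $ i ^ p) + 2 * e n a b" by simp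
    qed
    also have "\<dots> = ?Q n + 2 * (\<Sum>(a, b) \<in> intervals (\<pi> n). e n a b)"
      unfolding split_def
      by (subst sum.swap)
        (simp add: sum.distrib sum_distrib_left map_replicate prod_list_replicate)
    also have "\<dots> \<le> ?Q n + 2 * ?o n ^ p"
      using e_sum[OF that, of 2] by simp
    finally show ?thesis .
  qed
  have "eventually (\<lambda>n. ?Q n + 2 * ?o n ^ p < q + 1) sequentially"
    using order_tendstoD(2)[OF lim, of "q + 1"] by simp
  with eventually_ge_at_top[of 1]
  have "eventually (\<lambda>n. (\<Sum>(a, b) \<in> intervals (\<pi> n). \<bar>?E a b\<bar>) \<le> q + 1) sequentially"
  proof eventually_elim
    case (elim n)
    then show ?case using le[OF elim(1)] by linarith
  qed
  then show "\<exists>B. eventually (\<lambda>n. (\<Sum>(a, b) \<in> intervals (\<pi> n). \<bar>?E a b\<bar>) \<le> B) sequentially"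
    by (rule exI)
qed


section \<open>Taylor expansion\<close>

lemma Ck_iterated_partial_continuous:
  "Ck k f \<Longrightarrow> length I = k \<Longrightarrow> continuous_on UNIV (iterated_partial I f)"
proof (induction k arbitrary: f I)
  case (Suc k)
  then show ?case by (cases I) auto
qed simp

lemma sum_lists_Suc:
  fixes F :: "'d::finite list \<Rightarrow> real"
  shows "(\<Sum>I | length I = Suc k. F I) = (\<Sum>i\<in>UNIV. \<Sum>I | length I = k. F (i # I))"
proof -
  have "{I :: 'd list. length I = Suc k} = (\<lambda>(i, I). i # I) ` (UNIV \<times> {I. length I = k})"
    by (auto simp: length_Suc_conv image_iff)
  then have "(\<Sum>I | length I = Suc k. F I) = (\<Sum>(i, I) \<in> UNIV \<times> {I. length I = k}. F (i # I))"
    by (simp add: sum.reindex inj_on_def split_def)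
  then show ?thesis by (simp add: sum.cartesian_product)
qed

lemma tensor_inner_nabla_power:
  "tensor_inner k (nabla k f x) (tensor_power k v)
    = (\<Sum>I | length I = k. iterated_partial I f x * (\<Prod>i\<leftarrow>I. v $ i))"
  by (simp add: tensor_inner_def nabla_def tensor_power_def)

text \<open>\<open>iterated_partial\<close> applies its first index first, so peeling that index off
  leaves a form of order k of a partial derivative of f.\<close>

lemma tensor_inner_nabla_power_Suc:
  "tensor_inner (Suc k) (nabla (Suc k) f x) (tensor_power (Suc k) v)
    = (\<Sum>i\<in>UNIV. v $ i * tensor_inner k (nabla k (\<lambda>x. frechet_derivative f (at x) (axis i 1)) x)
        (tensor_power k v))"
  by (simp add: tensor_inner_nabla_power sum_lists_Suc sum_distrib_left mult_ac)

text \<open>Differentiating along v adds a partial derivative at the end of the list, whereas the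
  recursion removes the first index. Induction on k with f arbitrary reconciles the two: only the
  base case differentiates, by the chain rule.\<close>

lemma DERIV_tensor_inner_nabla:
  fixes f :: "real ^ 'd::finite \<Rightarrow> real"
  assumes "Ck n f" "k < n"
  shows "((\<lambda>s. tensor_inner k (nabla k f (x + s *\<^sub>R v)) (tensor_power k v)) has_real_derivative
    tensor_inner (Suc k) (nabla (Suc k) f (x + s *\<^sub>R v)) (tensor_power (Suc k) v)) (at s)"
  using assms
proof (induction k arbitrary: f n)
  case 0
  let ?f' = "frechet_derivative f (at (x + s *\<^sub>R v))"
  have f': "(f has_derivative ?f') (at (x + s *\<^sub>R v))"
    using 0 by (cases n) (auto simp: frechet_derivative_works)
  have "((\<lambda>s. x + s *\<^sub>R v) has_derivative (\<lambda>r. r *\<^sub>R v)) (at s)"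
    by (auto intro!: derivative_eq_intros)
  from has_derivative_compose[OF this f']
  have "((\<lambda>s. f (x + s *\<^sub>R v)) has_derivative (\<lambda>r. ?f' (r *\<^sub>R v))) (at s)" .
  moreover have lin: "linear ?f'" using f' by (rule has_derivative_linear)
  moreover have "?f' v = (\<Sum>i\<in>UNIV. v $ i * ?f' (axis i 1))"
    by (subst basis_expansion[symmetric])
      (simp add: linear_sum[OF lin] linear_cmul[OF lin] scalar_mult_eq_scaleR)
  ultimately have "((\<lambda>s. f (x + s *\<^sub>R v)) has_real_derivative
      (\<Sum>i\<in>UNIV. v $ i * ?f' (axis i 1))) (at s)"
    by (simp add: has_field_derivative_def linear_cmul[OF lin] mult.commute[of _ "sum _ _"] mult_commute_abs)
  then show ?case
    by (simp add: tensor_inner_nabla_power_Suc tensor_inner_nabla_power[of 0])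
next
  case (Suc k)
  then obtain m where m: "n = Suc m" by (cases n) auto
  show ?case
    unfolding tensor_inner_nabla_power_Suc[of "Suc k"]
    unfolding tensor_inner_nabla_power_Suc[of k f]
    by (intro DERIV_sum DERIV_cmult Suc.IH[of m]) (use Suc.prems m in auto)
qed

text \<open>One-dimensional Maclaurin expansion with Lagrange remainder of
  \<open>s \<mapsto> f (x + s v)\<close> on \<open>[0,1]\<close>.\<close>

lemma Taylor_tensor:
  fixes f :: "real ^ 'd::finite \<Rightarrow> real"
  assumes f: "Ck p f" and p: "p \<ge> 1"
  obtains \<theta> where "\<theta> \<in> {0..1}"
    "f (x + v) = f x
      + (\<Sum>k = 1..p - 1. 1 / fact k * tensor_inner k (nabla k f x) (tensor_power k v))
      + 1 / fact p * tensor_inner p (nabla p f (x + \<theta> *\<^sub>R v)) (tensor_power p v)"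
proof -
  define D where "D k s = tensor_inner k (nabla k f (x + s *\<^sub>R v)) (tensor_power k v)" for k s
  have D0: "D 0 = (\<lambda>s. f (x + s *\<^sub>R v))"
    by (rule ext) (simp add: D_def tensor_inner_nabla_power)
  have "\<forall>m t. m < p \<and> 0 \<le> t \<and> t \<le> 1 \<longrightarrow> DERIV (D m) t :> D (Suc m) t"
    unfolding D_def using DERIV_tensor_inner_nabla[OF f] by blast
  from Maclaurin2[OF zero_less_one D0 this] obtain \<theta> where \<theta>: "0 < \<theta>" "\<theta> \<le> 1"
    "f (x + v) = (\<Sum>m<p. D m 0 / fact m) + D p \<theta> / fact p"
    by auto
  have "{..<p} = insert 0 {1..p - 1}" using p by auto
  then have "f (x + v) = f x + (\<Sum>k = 1..p - 1. D k 0 / fact k) + D p \<theta> / fact p"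
    using \<theta>(3) D0 by simp
  then show ?thesis using \<theta> by (intro that[of \<theta>]) (auto simp: D_def)
qed


section \<open>The change of variable formula\<close>

text \<open>To be used with G a p-th order partial derivative and W the matching monomial of stopped
  increments. The intermediate point lies within the oscillation of \<open>S a\<close>, so the
  coefficients are uniformly small while the sums of \<open>\<bar>W a b\<bar>\<close> stay
  bounded.\<close>

lemma Taylor_remainder_tendsto_0:
  fixes S :: "real \<Rightarrow> real ^ 'd::finite"
  assumes G: "continuous_on UNIV (G :: real ^ 'd \<Rightarrow> real)"
    and part: "\<And>n. n \<ge> 1 \<Longrightarrow> is_partition T (\<pi> n)"
    and S: "continuous_on {0..T} S" "(\<lambda>n. osc S (\<pi> n)) \<longlonglongrightarrow> 0"
    and t: "t \<in> {0..T}"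
    and \<theta>: "\<And>n a b. \<theta> n a b \<in> {0..1}"
    and W: "eventually (\<lambda>n. (\<Sum>(a, b) \<in> intervals (\<pi> n). \<bar>W a b\<bar>) \<le> B) sequentially"
  shows "(\<lambda>n. \<Sum>(a, b) \<in> intervals (\<pi> n).
      (if a \<le> t then G (S a + \<theta> n a b *\<^sub>R (S (min b t) - S a)) - G (S a) else 0) * W a b) \<longlonglongrightarrow> 0"
    (is "?R \<longlonglongrightarrow> 0")
proof (rule tendstoI)
  fix \<epsilon> :: real assume "\<epsilon> > 0"
  \<comment> \<open>The summand 1 keeps the denominator positive and makes
    \<open>\<eta> * \<bar>B\<bar> < \<epsilon>\<close> strict.\<close>
  define \<eta> where "\<eta> = \<epsilon> / (\<bar>B\<bar> + 1)"
  have "\<eta> > 0" using \<open>\<epsilon> > 0\<close> by (simp add: \<eta>_def add_nonneg_pos)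
  \<comment> \<open>Intermediate points may leave the path, but a ball containing the path is convex
    and contains them as well.\<close>
  obtain c where c: "\<And>s. s \<in> {0..T} \<Longrightarrow> norm (S s) \<le> c"
    using continuous_on_interval_obtain_bound[OF S(1)] by blast
  have "uniformly_continuous_on (cball 0 c) G"
    by (intro compact_uniformly_continuous continuous_on_subset[OF G]) auto
  then obtain \<delta> where \<delta>: "\<delta> > 0"
    "\<And>x y. x \<in> cball 0 c \<Longrightarrow> y \<in> cball 0 c \<Longrightarrow> dist y x < \<delta> \<Longrightarrow> dist (G y) (G x) < \<eta>"
    using \<open>\<eta> > 0\<close> unfolding uniformly_continuous_on_def by metis
  have "eventually (\<lambda>n. osc S (\<pi> n) < \<delta>) sequentially"
    using order_tendstoD(2)[OF S(2) \<delta>(1)] .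
  with W eventually_ge_at_top[of 1] show "eventually (\<lambda>n. dist (?R n) 0 < \<epsilon>) sequentially"
  proof eventually_elim
    case (elim n)
    have "\<bar>?R n\<bar> \<le> (\<Sum>(a, b) \<in> intervals (\<pi> n). \<eta> * \<bar>W a b\<bar>)"
    proof (rule sum_abs[THEN order_trans], rule sum_mono, clarify)
      fix a b assume ab: "(a, b) \<in> intervals (\<pi> n)"
      note iv = intervalsD[OF part[OF elim(2)] ab]
      let ?y = "S a + \<theta> n a b *\<^sub>R (S (min b t) - S a)"
      have "\<bar>G ?y - G (S a)\<bar> < \<eta>" if "a \<le> t"
      proof -
        have m: "min b t \<in> {a..b}" "a \<in> {a..b}" "min b t \<in> {0..T}"
          using that iv t by auto
        have "S a \<in> cball 0 c" "S (min b t) \<in> cball 0 c" using c iv m by auto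
        moreover have "?y = (1 - \<theta> n a b) *\<^sub>R S a + \<theta> n a b *\<^sub>R S (min b t)"
          by (simp add: algebra_simps)
        ultimately have "?y \<in> cball 0 c"
          using \<theta>[of n a b] convexD[OF convex_cball, of "S a" 0 c "S (min b t)" "1 - \<theta> n a b" "\<theta> n a b"]
          by simp
        moreover have "norm (\<theta> n a b *\<^sub>R (S (min b t) - S a)) \<le> 1 * osc S (\<pi> n)"
          unfolding norm_scaleR
          using \<theta>[of n a b] norm_diff_le_osc[OF part[OF elim(2)] S(1) ab m(2,1)]
          by (intro mult_mono) auto
        ultimately show ?thesis
          using \<delta>(2)[of "S a" ?y] \<open>S a \<in> cball 0 c\<close> elim(3) by (simp add: dist_norm)
      qed
      then have "\<bar>if a \<le> t then G ?y - G (S a) else 0\<bar> \<le> \<eta>" using \<open>\<eta> > 0\<close> by auto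
      then show "\<bar>(if a \<le> t then G ?y - G (S a) else 0) * W a b\<bar> \<le> \<eta> * \<bar>W a b\<bar>"
        unfolding abs_mult by (rule mult_right_mono) simp
    qed
    also have "\<dots> = \<eta> * (\<Sum>(a, b) \<in> intervals (\<pi> n). \<bar>W a b\<bar>)"
      by (simp add: sum_distrib_left split_def)
    also have "\<dots> \<le> \<eta> * \<bar>B\<bar>"
      using elim(1) \<open>\<eta> > 0\<close> by (intro mult_left_mono) auto
    also have "\<dots> < \<epsilon>"
      using \<open>\<epsilon> > 0\<close> by (simp add: \<eta>_def field_simps add_nonneg_pos)
    finally show ?case by (simp add: dist_real_def)
  qed
qed

theorem theorem4p3:
  fixes T :: real and p :: nat and \<pi> :: "nat \<Rightarrow> real set"
    and S :: "real \<Rightarrow> real ^ 'd::finite" and f :: "real ^ 'd \<Rightarrow> real"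
  assumes "T > 0" and "p \<ge> 2" and "even p"
    and "\<And>n. n \<ge> 1 \<Longrightarrow> is_partition T (\<pi> n)"
    and "S \<in> Vp p T \<pi>" and "continuous_on {0..T} S"
    and "Ck p f"
  shows "\<forall>t \<in> {0..T}.
    convergent (\<lambda>n. compensated_sum p (\<pi> n) S f t) \<and>
    f (S t) - f (S 0) = rough_integral p \<pi> S f t
      + 1 / fact p * pth_variation_integral p T \<pi> S t (\<lambda>s. nabla p f (S s))"
proof
  fix t assume t: "t \<in> {0..T}"
  note part = assms(4) and S = assms(6)
  define \<mu> where "\<mu> = mu_S p T \<pi> S"
  \<comment> \<open>Membership in \<open>Vp\<close> supplies a variation measure, so the choice in
    \<open>mu_S\<close> returns one.\<close>
  have osc: "(\<lambda>n. osc S (\<pi> n)) \<longlonglongrightarrow> 0" and \<mu>: "pth_variation_measure p T \<pi> S \<mu>"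
    using assms(5) someI_ex[of "pth_variation_measure p T \<pi> S"]
    unfolding Vp_def \<mu>_def mu_S_def by blast+
  have p: "p > 0" "p \<ge> 1" using assms(2) by auto
  let ?w = "\<lambda>a b. S (min b t) - S (min a t)"
  let ?E = "\<lambda>I a b. \<Prod>i\<leftarrow>I. ?w a b $ i"
  let ?G = "\<lambda>I. iterated_partial I f"
  \<comment> \<open>Packaging the expansion as a predicate lets the intermediate parameter be chosen
    at once for all base points and increments.\<close>
  define Q where "Q x v \<theta> \<longleftrightarrow> \<theta> \<in> {0..1} \<and> f (x + v) = f x
      + (\<Sum>k = 1..p - 1. 1 / fact k * tensor_inner k (nabla k f x) (tensor_power k v))
      + 1 / fact p * tensor_inner p (nabla p f (x + \<theta> *\<^sub>R v)) (tensor_power p v)" for x v \<theta>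
  have "\<exists>\<theta>. Q x v \<theta>" for x v
    by (rule Taylor_tensor[OF assms(7) p(2)]) (unfold Q_def, blast)
  then obtain \<Theta> where "\<And>x v. Q x v (\<Theta> x v)"
    by metis
  then have \<Theta>: "\<Theta> x v \<in> {0..1}" "f (x + v) = f x
      + (\<Sum>k = 1..p - 1. 1 / fact k * tensor_inner k (nabla k f x) (tensor_power k v))
      + 1 / fact p * tensor_inner p (nabla p f (x + \<Theta> x v *\<^sub>R v)) (tensor_power p v)" for x v
    unfolding Q_def by blast+
  define \<theta> where "\<theta> a b = \<Theta> (S a) (S (min b t) - S a)" for a b
  \<comment> \<open>Change of the p-th derivative between \<open>S a\<close> and the intermediate
    point. Beyond t the stopped increment is 0 and \<open>S (min b t) - S a\<close> differs from it
    in general, so 0 is the value taken there.\<close>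
  define r where "r I a b = (if a \<le> t then ?G I (S a + \<theta> a b *\<^sub>R (S (min b t) - S a)) - ?G I (S a) else 0)"
    for I a b
  let ?A = "\<lambda>I n. \<Sum>(a, b) \<in> intervals (\<pi> n). ?G I (S a) * ?E I a b"
  let ?R = "\<lambda>I n. \<Sum>(a, b) \<in> intervals (\<pi> n). r I a b * ?E I a b"
  have increment: "f (S (min b t)) - f (S (min a t))
      = (\<Sum>k = 1..p - 1. 1 / fact k * tensor_inner k (nabla k f (S a)) (tensor_power k (?w a b)))
        + 1 / fact p * (\<Sum>I | length I = p. ?G I (S a) * ?E I a b + r I a b * ?E I a b)"
    if "a < b" for a b
  proof (cases "a \<le> t")
    case True
    then show ?thesis
      using \<Theta>(2)[of "S a" "S (min b t) - S a"]
      by (simp add: tensor_inner_nabla_power[of p] r_def \<theta>_def min_absorb1 algebra_simps)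
  next
    case False
    \<comment> \<open>Beyond t every term vanishes, because tensor powers of 0 of order at least 1
      are 0.\<close>
    have "(\<Prod>i\<leftarrow>I. (0 :: real ^ 'd) $ i) = 0" if "length I \<ge> 1" for I
      using that by (cases I) auto
    then have "tensor_inner k A (tensor_power k (0 :: real ^ 'd)) = 0" if "k \<ge> 1" for k A
      unfolding tensor_inner_def tensor_power_def using that by (intro sum.neutral) (auto simp del: zero_index)
    moreover have "?E I a b = 0" if "length I = p" for I
      using that p False \<open>a < b\<close> by (cases I) auto
    ultimately show ?thesis using False that by simp
  qed
  have expansion: "compensated_sum p (\<pi> n) S f t
      = f (S t) - f (S 0) - 1 / fact p * (\<Sum>I | length I = p. ?A I n + ?R I n)" if "n \<ge> 1" for n
  proof -
    \<comment> \<open>Telescoping the stopped function \<open>s \<mapsto> f (S (min s t))\<close>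
      over all of \<open>[0,T]\<close> gives its increment up to t.\<close>
    have "f (S t) - f (S 0)
        = (\<Sum>(a, b) \<in> intervals (\<pi> n). f (S (min b t)) - f (S (min a t)))"
      using sum_partition_telescope[OF part[OF that], of "\<lambda>s. f (S (min s t))"] t by simp
    also have "\<dots> = (\<Sum>(a, b) \<in> intervals (\<pi> n).
        (\<Sum>k = 1..p - 1. 1 / fact k * tensor_inner k (nabla k f (S a)) (tensor_power k (?w a b)))
        + 1 / fact p * (\<Sum>I | length I = p. ?G I (S a) * ?E I a b + r I a b * ?E I a b))"
      by (intro sum.cong refl) (auto simp: intervals_def increment)
    also have "\<dots> = compensated_sum p (\<pi> n) S f t
        + 1 / fact p * (\<Sum>(a, b) \<in> intervals (\<pi> n).
            \<Sum>I | length I = p. ?G I (S a) * ?E I a b + r I a b * ?E I a b)"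
      by (simp only: compensated_sum_def split_def sum.distrib sum_distrib_left distrib_left)
    also have "(\<Sum>(a, b) \<in> intervals (\<pi> n).
            \<Sum>I | length I = p. ?G I (S a) * ?E I a b + r I a b * ?E I a b)
        = (\<Sum>I | length I = p. ?A I n + ?R I n)"
      unfolding split_def by (subst sum.swap) (simp add: sum.distrib)
    finally show ?thesis by simp
  qed
  let ?L = "\<lambda>I. signed_integral (borel_upto T) (\<lambda>A. \<mu> A I) (\<lambda>s. indicator {0..t} s * ?G I (S s))"
  have "?A I \<longlonglongrightarrow> ?L I" "?R I \<longlonglongrightarrow> 0" if I: "length I = p" for I
  proof -
    have G: "continuous_on UNIV (?G I)"
      by (rule Ck_iterated_partial_continuous[OF assms(7) I])
    have "continuous_on {0..T} (\<lambda>s. ?G I (S s))"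
      using continuous_on_compose2[OF G S] by simp
    note stopped = stopped_monomial_sums_tendsto[OF \<mu> I assms(3) p(1) part S osc this t]
    show "?A I \<longlonglongrightarrow> ?L I" by (rule stopped)
    obtain B where "eventually (\<lambda>n. (\<Sum>(a, b) \<in> intervals (\<pi> n). \<bar>?E I a b\<bar>) \<le> B) sequentially"
      using stopped(2) by blast
    then show "?R I \<longlonglongrightarrow> 0"
      unfolding r_def
      by (intro Taylor_remainder_tendsto_0[OF G part S osc t]) (auto simp: \<theta>_def \<Theta>(1)[simplified])
  qed
  then have lim: "(\<lambda>n. f (S t) - f (S 0) - 1 / fact p * (\<Sum>I | length I = p. ?A I n + ?R I n))
      \<longlonglongrightarrow> f (S t) - f (S 0) - 1 / fact p * (\<Sum>I | length I = p. ?L I + 0)"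
    by (intro tendsto_intros) auto
  have L: "(\<Sum>I | length I = p. ?L I + 0)
      = pth_variation_integral p T \<pi> S t (\<lambda>s. nabla p f (S s))"
    unfolding pth_variation_integral_def tensor_integral_def \<mu>_def[symmetric]
    by (intro sum.cong) (auto simp: nabla_def)
  \<comment> \<open>The identity is claimed only eventually, since \<open>\<pi> 0\<close> need not
    be a partition.\<close>
  have "eventually (\<lambda>n. f (S t) - f (S 0) - 1 / fact p * (\<Sum>I | length I = p. ?A I n + ?R I n)
      = compensated_sum p (\<pi> n) S f t) sequentially"
    by (rule eventually_mono[OF eventually_ge_at_top[of 1]]) (rule expansion[symmetric])
  from Lim_transform_eventually[OF lim[unfolded L] this] have "(\<lambda>n. compensated_sum p (\<pi> n) S f t)
      \<longlonglongrightarrow> f (S t) - f (S 0) - 1 / fact p * pth_variation_integral p T \<pi> S t (\<lambda>s. nabla p f (S s))" .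
  then show "convergent (\<lambda>n. compensated_sum p (\<pi> n) S f t) \<and>
    f (S t) - f (S 0) = rough_integral p \<pi> S f t
      + 1 / fact p * pth_variation_integral p T \<pi> S t (\<lambda>s. nabla p f (S s))"
    unfolding rough_integral_def by (auto simp: convergent_def dest: limI)
qed

end
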